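(* Let $\mathbf{X}=(X_1,\dots,X_n)$ and $\mathbf{Y}=(Y_1,\dots,Y_n)$ be vectors of $n$ independent Bernoulli random variables with success probabilities $p_1,\dots,p_n$ and $q_1,\dots,q_n$, respectively, where $0<p_i\le q_i<1$ for all $i\in\{1,\dots,n\}$. For $i\in\{1,\dots,n\}$ put $\beta_i:=\frac{p_i}{1-p_i}\,\frac{1-q_i}{q_i}$. Then the following statements are equivalent: (i) All $\beta_i$ ($i\in\{1,\dots,n\}$) are equal; (ii) $\mathcal{L}(\mathbf{X}\mid\sum_{i=1}^nX_i=k)=\mathcal{L}(\mathbf{Y}\mid\sum_{i=1}^nY_i=k)$ for all $k\in\{0,1,\dots,n\}$; (iii) $\mathcal{L}(\mathbf{X}\mid\sum_{i=1}^nX_i=k)=\mathcal{L}(\mathbf{Y}\mid\sum_{i=1}^nY_i=k)$ for some $k\in\{1,\dots,n-1\}$.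
   Context: $\mathcal{L}(\mathbf{X}\mid A)$ denotes the conditional law of $\mathbf{X}$ given the event $A$, and similarly for $\mathbf{Y}$.
   Formalization: The equivalence of (iii) with (i) and (ii) is stated only for n ≥ 2, since for n ≤ 1 the range {1,…,n−1} is empty and (iii) fails while (i) and (ii) hold; (i) ⇔ (ii) is stated for every n. *)

theory Defs
  imports "HOL-Probability.Probability"
begin

text \<open>A Bernoulli variable has values in \<open>nat\<close>, so that sums of Bernoulli variables count
  successes. Only its law is prescribed: it is \<open>0\<close> or \<open>1\<close> almost surely.\<close>

definition bernoulli_rv :: "'a measure \<Rightarrow> ('a \<Rightarrow> nat) \<Rightarrow> real \<Rightarrow> bool" where
  "bernoulli_rv M X p \<longleftrightarrow>
     X \<in> measurable M (count_space UNIV) \<and>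
     distr M (count_space UNIV) X = measure_pmf (map_pmf of_bool (bernoulli_pmf p))"

definition independent_bernoullis ::
    "'a measure \<Rightarrow> nat \<Rightarrow> (nat \<Rightarrow> 'a \<Rightarrow> nat) \<Rightarrow> (nat \<Rightarrow> real) \<Rightarrow> bool" where
  "independent_bernoullis M n X p \<longleftrightarrow>
     prob_space M \<and>
     prob_space.indep_vars M (\<lambda>_. count_space UNIV) X {1..n} \<and>
     (\<forall>i\<in>{1..n}. bernoulli_rv M (X i) (p i))"

text \<open>The law, on the product space over \<open>{1..n}\<close>, of the vector \<open>(X 1, \<dots>, X n)\<close> under the
  conditional measure \<open>M(\<sqdot> \<inter> A) / M(A)\<close>, which is what \<^const>\<open>uniform_measure\<close> denotes.
  It is meaningful only if \<open>A\<close> has positive probability.\<close>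

definition cond_law ::
    "'a measure \<Rightarrow> nat \<Rightarrow> (nat \<Rightarrow> 'a \<Rightarrow> nat) \<Rightarrow> 'a set \<Rightarrow> (nat \<Rightarrow> nat) measure" where
  "cond_law M n X A =
     distr (uniform_measure M A) (Pi\<^sub>M {1..n} (\<lambda>_. count_space UNIV)) (\<lambda>\<omega>. \<lambda>i\<in>{1..n}. X i \<omega>)"

definition sum_event :: "'a measure \<Rightarrow> nat \<Rightarrow> (nat \<Rightarrow> 'a \<Rightarrow> nat) \<Rightarrow> nat \<Rightarrow> 'a set" where
  "sum_event M n X k = {\<omega> \<in> space M. (\<Sum>i=1..n. X i \<omega>) = k}"

end

theory Submission
  imports Defs
begin

text \<open>The odds ratio satisfies
  \<open>P(X i = m) / P(Y i = m) = (1 - p i) / (1 - q i) * \<beta> i ^ m\<close> for \<open>m \<in> {0, 1}\<close>. If all \<open>\<beta> i\<close>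
  agree, the likelihood ratio of a configuration therefore depends on its sum alone, and conditioning
  on the sum removes it. Conversely, when \<open>0 < k < n\<close>, there are two configurations of sum \<open>k\<close> that
  differ only by moving one success from \<open>i\<close> to \<open>j\<close>; comparing their conditional
  probabilities gives \<open>\<beta> i = \<beta> j\<close>.\<close>

section \<open>Point probabilities of a single Bernoulli variable with values in the
  naturals\<close>

definition bernoulli_weight :: "real \<Rightarrow> nat \<Rightarrow> real" where
  "bernoulli_weight p m = (if m = 0 then 1 - p else if m = 1 then p else 0)"

lemma bernoulli_weight_simps [simp]:
  "bernoulli_weight p 0 = 1 - p" "bernoulli_weight p (Suc 0) = p"
  by (simp_all add: bernoulli_weight_def)

lemma pmf_map_of_bool_bernoulli:
  assumes "0 \<le> p" "p \<le> 1"
  shows "pmf (map_pmf of_bool (bernoulli_pmf p)) (m::nat) = bernoulli_weight p m"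
proof -
  have inj: "inj (of_bool :: bool \<Rightarrow> nat)"
    by (auto simp: inj_on_def)
  consider "m = of_bool False" | "m = of_bool True" | "m > 1"
    by (cases m) force+
  then show ?thesis
  proof cases
    case 1
    then show ?thesis
      using assms pmf_map_inj'[OF inj, of "bernoulli_pmf p" False] by simp
  next
    case 2
    then show ?thesis
      using assms pmf_map_inj'[OF inj, of "bernoulli_pmf p" True] by simp
  next
    case 3
    then have "m \<notin> set_pmf (map_pmf of_bool (bernoulli_pmf p))"
      by (auto simp: of_bool_def split: if_splits)
    then have "pmf (map_pmf of_bool (bernoulli_pmf p)) m = 0"
      by (simp only: set_pmf_iff not_not)
    with 3 show ?thesis
      by (simp add: bernoulli_weight_def)
  qed
qed

text \<open>Beyond 1 both weights vanish, so the identity covers every natural \<open>m\<close>.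
  With the odds ratio written as a power, a common ratio multiplies over the coordinates to a power
  whose exponent is the sum of the entries.\<close>

lemma bernoulli_weight_odds_ratio:
  assumes "0 < p" "p < 1" "0 < q" "q < 1"
  shows "bernoulli_weight p m =
    (1 - p) / (1 - q) * (p / (1 - p) * ((1 - q) / q)) ^ m * bernoulli_weight q m"
  using assms by (simp add: bernoulli_weight_def)

lemma measure_bernoulli_rv_eq:
  assumes "bernoulli_rv M X p" "0 \<le> p" "p \<le> 1"
  shows "measure M (X -` {m} \<inter> space M) = bernoulli_weight p m"
proof -
  from assms have X: "X \<in> measurable M (count_space UNIV)"
    and D: "distr M (count_space UNIV) X = measure_pmf (map_pmf of_bool (bernoulli_pmf p))"
    by (auto simp: bernoulli_rv_def)
  have "measure M (X -` {m} \<inter> space M) = measure (distr M (count_space UNIV) X) {m}"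
    using X by (simp add: measure_distr)
  also have "\<dots> = pmf (map_pmf of_bool (bernoulli_pmf p)) m"
    by (simp add: D pmf.rep_eq)
  finally show ?thesis
    using assms by (simp add: pmf_map_of_bool_bernoulli)
qed

text \<open>A finite product of countable discrete spaces is discrete. Singletons are therefore
  measurable, and conditional laws can be compared point by point.\<close>

lemma PiM_count_space_nat:
  "PiM {1..n::nat} (\<lambda>_. count_space (UNIV :: nat set)) = count_space (PiE {1..n} (\<lambda>_. UNIV))"
  by (rule count_space_PiM_finite) simp_all

section \<open>Configurations, sums and conditional laws of one Bernoulli vector\<close>

locale bernoulli_vector =
  fixes M :: "'a measure" and n :: nat and X :: "nat \<Rightarrow> 'a \<Rightarrow> nat" and p :: "nat \<Rightarrow> real"
  assumes indep_bernoullis: "independent_bernoullis M n X p"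
    and success_prob: "i \<in> {1..n} \<Longrightarrow> 0 < p i \<and> p i < 1"

sublocale bernoulli_vector \<subseteq> prob_space M
  using indep_bernoullis by (simp add: independent_bernoullis_def)

context bernoulli_vector
begin

lemma random_variable_X [measurable]: "i \<in> {1..n} \<Longrightarrow> X i \<in> measurable M (count_space UNIV)"
  using indep_bernoullis by (auto simp: independent_bernoullis_def bernoulli_rv_def)

definition config_event :: "(nat \<Rightarrow> nat) \<Rightarrow> 'a set" where
  "config_event f = {\<omega> \<in> space M. \<forall>i\<in>{1..n}. X i \<omega> = f i}"

definition config_weight :: "(nat \<Rightarrow> nat) \<Rightarrow> real" where
  "config_weight f = (\<Prod>i\<in>{1..n}. bernoulli_weight (p i) (f i))"

lemma sets_config_event [measurable]: "config_event f \<in> sets M"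
  unfolding config_event_def by measurable

lemma sets_sum_event [measurable]: "sum_event M n X k \<in> sets M"
  unfolding sum_event_def by measurable

lemma prob_config_event: "prob (config_event f) = config_weight f"
\<comment> \<open>For \<open>n = 0\<close> the intersection over the coordinates would be
  \<open>UNIV\<close> instead of \<open>space M\<close>.\<close>
proof (cases "n = 0")
  case True
  then have "config_event f = space M" "config_weight f = 1"
    unfolding config_event_def config_weight_def by auto
  then show ?thesis
    by (simp add: prob_space)
next
  case False
  have "config_event f = (\<Inter>i\<in>{1..n}. X i -` {f i} \<inter> space M)"
    using False by (auto simp: config_event_def)
  also have "prob \<dots> = (\<Prod>i\<in>{1..n}. prob (X i -` {f i} \<inter> space M))"
    using indep_bernoullis False
    by (intro indep_varsD_finite[where M' = "\<lambda>_. count_space UNIV"])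
       (auto simp: independent_bernoullis_def)
  also have "\<dots> = config_weight f"
    unfolding config_weight_def
  proof (intro prod.cong refl measure_bernoulli_rv_eq)
    fix i assume i: "i \<in> {1..n}"
    show "bernoulli_rv M (X i) (p i)"
      using indep_bernoullis i by (auto simp: independent_bernoullis_def)
    show "0 \<le> p i" "p i \<le> 1"
      using success_prob[OF i] by auto
  qed
  finally show ?thesis .
qed

lemma config_weight_pos:
  assumes "\<And>i. i \<in> {1..n} \<Longrightarrow> f i \<le> 1"
  shows "0 < config_weight f"
  unfolding config_weight_def
proof (rule prod_pos)
  fix i assume i: "i \<in> {1..n}"
  then show "0 < bernoulli_weight (p i) (f i)"
    using success_prob[OF i] assms[OF i] by (auto simp: bernoulli_weight_def)
qed

text \<open>The event splits into finitely many disjoint configuration events, since a sum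
  \<open>k\<close> of naturals bounds each term by \<open>k\<close>. The entries range up to
  \<open>k\<close> rather than 1 because the variables are 0 or 1 only almost surely; configurations
  with an entry above 1 have weight 0.\<close>

lemma prob_sum_event:
  "prob (sum_event M n X k) =
     (\<Sum>f | f \<in> PiE {1..n} (\<lambda>_. {..k}) \<and> (\<Sum>i=1..n. f i) = k. config_weight f)"
proof -
  let ?F = "{f. f \<in> PiE {1..n} (\<lambda>_. {..k}) \<and> (\<Sum>i=1..n. f i) = k}"
  have fin: "finite ?F"
    by (rule finite_subset[of _ "PiE {1..n} (\<lambda>_. {..k})"]) (auto intro!: finite_PiE)
  have "sum_event M n X k = (\<Union>f\<in>?F. config_event f)"
  proof (intro equalityI subsetI)
    fix \<omega> assume "\<omega> \<in> sum_event M n X k"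
    then have \<omega>: "\<omega> \<in> space M" "(\<Sum>i=1..n. X i \<omega>) = k"
      by (auto simp: sum_event_def)
    have "X i \<omega> \<le> k" if "i \<in> {1..n}" for i
      using member_le_sum[of i "{1..n}" "\<lambda>i. X i \<omega>"] that \<omega>(2) by simp
    with \<omega> have "(\<lambda>i\<in>{1..n}. X i \<omega>) \<in> ?F" "\<omega> \<in> config_event (\<lambda>i\<in>{1..n}. X i \<omega>)"
      by (auto simp: config_event_def)
    then show "\<omega> \<in> (\<Union>f\<in>?F. config_event f)"
      by blast
  next
    fix \<omega> assume "\<omega> \<in> (\<Union>f\<in>?F. config_event f)"
    then show "\<omega> \<in> sum_event M n X k"
      by (auto simp: sum_event_def config_event_def)
  qed
  moreover have "disjoint_family_on config_event ?F"
    unfolding disjoint_family_on_def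
  proof (intro ballI impI)
    fix f g assume fg: "f \<in> ?F" "g \<in> ?F" "f \<noteq> g"
    \<comment> \<open>Both functions are \<open>undefined\<close> outside \<open>{1..n}\<close>, so
      they must differ at an index inside.\<close>
    then obtain i where "i \<in> {1..n}" "f i \<noteq> g i"
      using PiE_ext[of f "{1..n}" "\<lambda>_. {..k}" g] by auto
    then show "config_event f \<inter> config_event g = {}"
      by (auto simp: config_event_def)
  qed
  ultimately show ?thesis
    using finite_measure_finite_Union[OF fin, of config_event]
    by (simp add: prob_config_event image_subset_iff sets_config_event)
qed

text \<open>The configuration with ones exactly at the first \<open>k\<close> indices lies in the
  event and has positive weight. Hence every conditioning in the theorem is on an event of positive
  probability.\<close>

lemma prob_sum_event_pos:
  assumes "k \<le> n"
  shows "0 < prob (sum_event M n X k)"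
proof -
  let ?f = "\<lambda>i. of_bool (i \<le> k) :: nat"
  have "(\<Sum>i=1..n. ?f i) = card {i \<in> {1..n}. i \<le> k}"
    by (simp add: sum.If_cases of_bool_def Int_def)
  also have "{i \<in> {1..n}. i \<le> k} = {1..k}"
    using assms by auto
  finally have "(\<Sum>i=1..n. ?f i) = k"
    by simp
  moreover have "(\<Sum>i=1..n. X i \<omega>) = (\<Sum>i=1..n. ?f i)" if "\<omega> \<in> config_event ?f" for \<omega>
    using that unfolding config_event_def by (intro sum.cong) blast+
  ultimately have "config_event ?f \<subseteq> sum_event M n X k"
    unfolding sum_event_def using sets.sets_into_space[OF sets_config_event] by fastforce
  then have "config_weight ?f \<le> prob (sum_event M n X k)"
    using finite_measure_mono[of "config_event ?f"] by (simp add: prob_config_event)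
  moreover have "0 < config_weight ?f"
    by (rule config_weight_pos) auto
  ultimately show ?thesis
    by linarith
qed

lemma sets_cond_law: "sets (cond_law M n X A) = Pow (PiE {1..n} (\<lambda>_. UNIV))"
  unfolding cond_law_def PiM_count_space_nat by simp

text \<open>A configuration determines its sum, so its event is either contained in the conditioning
  event or disjoint from it.\<close>

lemma emeasure_cond_law:
  assumes "k \<le> n" and f: "f \<in> PiE {1..n} (\<lambda>_. UNIV)"
  shows "emeasure (cond_law M n X (sum_event M n X k)) {f} =
    ennreal (if (\<Sum>i=1..n. f i) = k then config_weight f / prob (sum_event M n X k) else 0)"
proof -
  let ?A = "sum_event M n X k"
  let ?V = "\<lambda>\<omega>. \<lambda>i\<in>{1..n}. X i \<omega>"
  have V: "?V \<in> measurable (uniform_measure M ?A) (PiM {1..n} (\<lambda>_. count_space UNIV))"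
    by (intro measurable_restrict) (simp add: measurable_cong_sets[OF sets_uniform_measure refl])
  have "?V -` {f} \<inter> space M = config_event f"
  proof -
    have "?V \<omega> = f \<longleftrightarrow> (\<forall>i\<in>{1..n}. X i \<omega> = f i)" for \<omega>
      using f by (auto simp: fun_eq_iff PiE_def extensional_def restrict_def)
    then show ?thesis
      by (auto simp: config_event_def)
  qed
  then have "emeasure (cond_law M n X ?A) {f} = emeasure (uniform_measure M ?A) (config_event f)"
    unfolding cond_law_def using f
    by (subst emeasure_distr[OF V]) (simp_all only: PiM_count_space_nat, simp_all)
  also have "\<dots> = emeasure M (?A \<inter> config_event f) / emeasure M ?A"
    by simp
  also have "\<dots> = ennreal (prob (?A \<inter> config_event f) / prob ?A)"
    using prob_sum_event_pos[OF \<open>k \<le> n\<close>] by (simp add: emeasure_eq_measure divide_ennreal)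
  also have "?A \<inter> config_event f = (if (\<Sum>i=1..n. f i) = k then config_event f else {})"
    by (auto simp: sum_event_def config_event_def)
  finally show ?thesis
    by (auto simp: prob_config_event)
qed

text \<open>Isolates the two coordinates between which a success is moved; \<open>R f\<close>
  depends only on the entries left alone.\<close>

lemma config_weight_two_coordinates:
  assumes "i \<in> {1..n}" "j \<in> {1..n}" "i \<noteq> j"
  defines "R \<equiv> \<lambda>f. \<Prod>l\<in>{1..n} - {i, j}. bernoulli_weight (p l) (f l)"
  shows "config_weight f = bernoulli_weight (p i) (f i) * bernoulli_weight (p j) (f j) * R f"
proof -
  have "{1..n} = insert i (insert j ({1..n} - {i, j}))"
    using assms by auto
  then have "config_weight f =
      (\<Prod>l\<in>insert i (insert j ({1..n} - {i, j})). bernoulli_weight (p l) (f l))"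
    unfolding config_weight_def by simp
  then show ?thesis
    using assms(3) by (simp add: R_def mult.assoc)
qed

end

section \<open>Comparison of the conditional laws of two vectors\<close>

locale bernoulli_vector_pair =
  X: bernoulli_vector M n X p + Y: bernoulli_vector N n Y q
  for M :: "'a measure" and N :: "'b measure" and n :: nat
    and X :: "nat \<Rightarrow> 'a \<Rightarrow> nat" and Y :: "nat \<Rightarrow> 'b \<Rightarrow> nat" and p q :: "nat \<Rightarrow> real" +
  fixes \<beta> :: "nat \<Rightarrow> real"
  assumes odds_ratio: "i \<in> {1..n} \<Longrightarrow> \<beta> i = p i / (1 - p i) * ((1 - q i) / q i)"
begin

text \<open>On configurations of sum \<open>k\<close> the two weights are proportional, with a
  factor \<open>c\<close> independent of the configuration. Summing gives the same factor for the
  normalising probabilities, so it cancels in the quotients.\<close>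

lemma cond_law_eq_if_odds_ratios_eq:
  assumes b: "\<And>i. i \<in> {1..n} \<Longrightarrow> \<beta> i = b" and k: "k \<le> n"
  shows "cond_law M n X (sum_event M n X k) = cond_law N n Y (sum_event N n Y k)"
proof -
  define c where "c = (\<Prod>i\<in>{1..n}. (1 - p i) / (1 - q i)) * b ^ k"
  have weight: "X.config_weight f = c * Y.config_weight f" if "(\<Sum>i=1..n. f i) = k" for f
  proof -
    have "X.config_weight f =
        (\<Prod>i\<in>{1..n}. (1 - p i) / (1 - q i) * b ^ f i * bernoulli_weight (q i) (f i))"
      unfolding X.config_weight_def
    proof (intro prod.cong refl)
      fix i assume i: "i \<in> {1..n}"
      show "bernoulli_weight (p i) (f i) =
          (1 - p i) / (1 - q i) * b ^ f i * bernoulli_weight (q i) (f i)"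
        using bernoulli_weight_odds_ratio[of "p i" "q i" "f i"] X.success_prob[OF i]
          Y.success_prob[OF i] odds_ratio[OF i] b[OF i] by simp
    qed
    also have "\<dots> = c * Y.config_weight f"
      unfolding c_def Y.config_weight_def that[symmetric] power_sum prod.distrib ..
    finally show ?thesis .
  qed
  have total: "X.prob (sum_event M n X k) = c * Y.prob (sum_event N n Y k)"
    unfolding X.prob_sum_event Y.prob_sum_event sum_distrib_left
    by (intro sum.cong refl weight) auto
  \<comment> \<open>The left side of \<open>total\<close> is positive, which permits cancelling
    \<open>c\<close>.\<close>
  then have "c \<noteq> 0"
    using X.prob_sum_event_pos[OF k] by auto
  show ?thesis
  proof (rule measure_eqI_countable[OF X.sets_cond_law Y.sets_cond_law])
    show "countable (PiE {1..n} (\<lambda>_. UNIV :: nat set))"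
      by (intro countable_PiE) auto
  next
    fix f :: "nat \<Rightarrow> nat" assume "f \<in> PiE {1..n} (\<lambda>_. UNIV)"
    then show "emeasure (cond_law M n X (sum_event M n X k)) {f} =
        emeasure (cond_law N n Y (sum_event N n Y k)) {f}"
      using \<open>c \<noteq> 0\<close> by (auto simp: X.emeasure_cond_law Y.emeasure_cond_law k weight total)
  qed
qed

text \<open>Equal conditional laws force the quotient of the two weights to be the same,
  \<open>a / b\<close>, for all 0/1 configurations of sum \<open>k\<close>. Comparing two of them
  eliminates the normalising probabilities \<open>a\<close> and \<open>b\<close>.\<close>

lemma config_weight_cross_eq:
  assumes eq: "cond_law M n X (sum_event M n X k) = cond_law N n Y (sum_event N n Y k)"
    and k: "k \<le> n"
    and f: "f \<in> PiE {1..n} (\<lambda>_. {..1})" "(\<Sum>i=1..n. f i) = k"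
    and g: "g \<in> PiE {1..n} (\<lambda>_. {..1})" "(\<Sum>i=1..n. g i) = k"
  shows "X.config_weight f * Y.config_weight g = X.config_weight g * Y.config_weight f"
proof -
  define a b where "a = X.prob (sum_event M n X k)" and "b = Y.prob (sum_event N n Y k)"
  have pos: "0 < a" "0 < b"
    using X.prob_sum_event_pos[OF k] Y.prob_sum_event_pos[OF k] by (auto simp: a_def b_def)
  have ratio: "X.config_weight h * b = Y.config_weight h * a"
    if h: "h \<in> PiE {1..n} (\<lambda>_. {..1})" "(\<Sum>i=1..n. h i) = k" for h
  proof -
    have h': "h \<in> PiE {1..n} (\<lambda>_. UNIV)" "\<And>i. i \<in> {1..n} \<Longrightarrow> h i \<le> 1"
      using h(1) by (auto simp: PiE_iff)
    \<comment> \<open>\<open>ennreal\<close> sends all negative reals to 0, so signs are needed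
      before it can be removed.\<close>
    have "0 < X.config_weight h" "0 < Y.config_weight h"
      using X.config_weight_pos Y.config_weight_pos h'(2) by blast+
    moreover have "ennreal (X.config_weight h / a) = ennreal (Y.config_weight h / b)"
      using X.emeasure_cond_law[OF k h'(1)] Y.emeasure_cond_law[OF k h'(1)] eq h(2)
      by (simp add: a_def b_def)
    ultimately have "X.config_weight h / a = Y.config_weight h / b"
      using pos by (simp add: ennreal_inj)
    then show ?thesis
      using pos by (simp add: field_simps)
  qed
  have "(X.config_weight f * Y.config_weight g) * (a * b) =
      (X.config_weight f * b) * (Y.config_weight g * a)"
    by simp
  also have "\<dots> = (X.config_weight g * Y.config_weight f) * (a * b)"
    by (simp add: ratio[OF f] flip: ratio[OF g])
  finally show ?thesis
    using pos by simp
qed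

lemma odds_ratios_eq_if_cond_law_eq:
  assumes eq: "cond_law M n X (sum_event M n X k) = cond_law N n Y (sum_event N n Y k)"
    and k: "k \<in> {1..n - 1}" and i: "i \<in> {1..n}" and j: "j \<in> {1..n}"
  shows "\<beta> i = \<beta> j"
proof (cases "i = j")
  case False
  have "card ({1..n} - {i, j}) = n - 2"
    using i j False by (simp add: card_Diff_subset)
  \<comment> \<open>The upper bound on \<open>k\<close> leaves room for \<open>k - 1\<close>
    successes away from \<open>i\<close> and \<open>j\<close>. The lower bound makes this
    subtraction exact, so that one further success gives the sum \<open>k\<close>.\<close>
  then have "k - 1 \<le> card ({1..n} - {i, j})"
    using k by auto
  then obtain S where S: "S \<subseteq> {1..n} - {i, j}" "card S = k - 1" "finite S"
    by (rule obtain_subset_with_card_n)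
  \<comment> \<open>\<open>f i\<close> and \<open>f j\<close> share the successes in
    \<open>S\<close>; the last success sits at \<open>i\<close> or at \<open>j\<close>.\<close>
  define f where "f x = (\<lambda>l\<in>{1..n}. of_bool (l \<in> insert x S) :: nat)" for x
  have f: "f x \<in> PiE {1..n} (\<lambda>_. {..1})" "(\<Sum>l=1..n. f x l) = k" if "x \<in> {i, j}" for x
  proof -
    show "f x \<in> PiE {1..n} (\<lambda>_. {..1})"
      by (auto simp: f_def)
    have "(\<Sum>l=1..n. f x l) = card ({1..n} \<inter> insert x S)"
      by (simp add: f_def of_bool_def sum.If_cases Int_def)
    also have "{1..n} \<inter> insert x S = insert x S"
      using S that i j by auto
    also have "card (insert x S) = k"
      using S that k by (subst card_insert_disjoint) auto
    finally show "(\<Sum>l=1..n. f x l) = k" .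
  qed
  have "k \<le> n"
    using k by auto
  have cross: "X.config_weight (f i) * Y.config_weight (f j) =
      X.config_weight (f j) * Y.config_weight (f i)"
    using f by (intro config_weight_cross_eq[OF eq \<open>k \<le> n\<close>]) auto
  define R where "R r = (\<Prod>l\<in>{1..n} - {i, j}. bernoulli_weight (r l) (f i l))" for r
  \<comment> \<open>Away from \<open>i\<close> and \<open>j\<close> the two configurations agree, so
    they have the same residual factor.\<close>
  have R': "R r = (\<Prod>l\<in>{1..n} - {i, j}. bernoulli_weight (r l) (f j l))" for r
    unfolding R_def by (intro prod.cong) (auto simp: f_def)
  have val: "f i i = 1" "f i j = 0" "f j i = 0" "f j j = 1"
    using i j False S by (auto simp: f_def)
  have wX: "X.config_weight (f i) = p i * (1 - p j) * R p"
      "X.config_weight (f j) = (1 - p i) * p j * R p"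
    using X.config_weight_two_coordinates[OF i j False, of "f i"]
      X.config_weight_two_coordinates[OF i j False, of "f j"] val
    unfolding R_def[symmetric] R'[symmetric] by simp_all
  have wY: "Y.config_weight (f i) = q i * (1 - q j) * R q"
      "Y.config_weight (f j) = (1 - q i) * q j * R q"
    using Y.config_weight_two_coordinates[OF i j False, of "f i"]
      Y.config_weight_two_coordinates[OF i j False, of "f j"] val
    unfolding R_def[symmetric] R'[symmetric] by simp_all
  \<comment> \<open>Positivity of the full weights shows that neither residual factor vanishes; both
    then cancel from \<open>cross\<close>.\<close>
  have "f i l \<le> 1" if "l \<in> {1..n}" for l
    using f(1)[of i] that by (auto simp: PiE_iff)
  then have "X.config_weight (f i) \<noteq> 0" "Y.config_weight (f i) \<noteq> 0"
    using X.config_weight_pos[of "f i"] Y.config_weight_pos[of "f i"] by auto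
  then have "R p \<noteq> 0" "R q \<noteq> 0"
    by (auto simp: wX wY)
  moreover have "(p i * (1 - p j) * ((1 - q i) * q j)) * (R p * R q) =
      ((1 - p i) * p j * (q i * (1 - q j))) * (R p * R q)"
    using cross unfolding wX wY by (simp only: ac_simps)
  ultimately have "p i * (1 - p j) * ((1 - q i) * q j) = (1 - p i) * p j * (q i * (1 - q j))"
    by simp
  then have "(p i * (1 - q i)) / ((1 - p i) * q i) = (p j * (1 - q j)) / ((1 - p j) * q j)"
    using X.success_prob[OF i] X.success_prob[OF j] Y.success_prob[OF i] Y.success_prob[OF j]
    by (subst frac_eq_eq) (simp_all add: ac_simps)
  then show ?thesis
    by (simp add: odds_ratio[OF i] odds_ratio[OF j])
qed simp

end

section \<open>The equivalences, with vectors of fewer than two coordinates treated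
  separately\<close>

theorem proposition1p2:
  fixes M :: "'a measure" and N :: "'b measure"
    and n :: nat
    and X :: "nat \<Rightarrow> 'a \<Rightarrow> nat" and Y :: "nat \<Rightarrow> 'b \<Rightarrow> nat"
    and p q \<beta> :: "nat \<Rightarrow> real"
  assumes "independent_bernoullis M n X p"
    and "independent_bernoullis N n Y q"
    and "\<And>i. i \<in> {1..n} \<Longrightarrow> 0 < p i \<and> p i \<le> q i \<and> q i < 1"
    and "\<And>i. i \<in> {1..n} \<Longrightarrow> \<beta> i = p i / (1 - p i) * ((1 - q i) / q i)"
  shows "((\<forall>i\<in>{1..n}. \<forall>j\<in>{1..n}. \<beta> i = \<beta> j) \<longleftrightarrow>
          (\<forall>k\<in>{0..n}. cond_law M n X (sum_event M n X k) = cond_law N n Y (sum_event N n Y k)))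
       \<and> (2 \<le> n \<longrightarrow>
          ((\<forall>k\<in>{0..n}. cond_law M n X (sum_event M n X k) = cond_law N n Y (sum_event N n Y k)) \<longleftrightarrow>
           (\<exists>k\<in>{1..n-1}. cond_law M n X (sum_event M n X k) = cond_law N n Y (sum_event N n Y k))))"
proof -
  interpret bernoulli_vector_pair M N n X Y p q \<beta>
  proof
    fix i assume i: "i \<in> {1..n}"
    show "0 < p i \<and> p i < 1" "0 < q i \<and> q i < 1"
      using assms(3)[OF i] by auto
    show "\<beta> i = p i / (1 - p i) * ((1 - q i) / q i)"
      using assms(4)[OF i] .
  qed (fact assms)+
  let ?eq = "\<lambda>k. cond_law M n X (sum_event M n X k) = cond_law N n Y (sum_event N n Y k)"
  let ?i = "\<forall>i\<in>{1..n}. \<forall>j\<in>{1..n}. \<beta> i = \<beta> j"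
  have i_ii: "\<forall>k\<in>{0..n}. ?eq k" if ?i
  proof
    fix k assume k: "k \<in> {0..n}"
    \<comment> \<open>The common value is taken to be \<open>\<beta> 1\<close>: the index 1 is in
      range as soon as any index is, and for \<open>n = 0\<close> the claim is vacuous.\<close>
    have "\<beta> i = \<beta> 1" if "i \<in> {1..n}" for i
    proof -
      have "1 \<in> {1..n}"
        using that by simp
      with that \<open>?i\<close> show ?thesis
        by blast
    qed
    then show "?eq k"
    proof (rule cond_law_eq_if_odds_ratios_eq)
      show "k \<le> n"
        using k by simp
    qed
  qed
  have iii_i: ?i if iii: "\<exists>k\<in>{1..n-1}. ?eq k"
  proof -
    from iii obtain k where "k \<in> {1..n-1}" "?eq k" ..
    then show ?thesis
      by (intro ballI odds_ratios_eq_if_cond_law_eq)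
  qed
  \<comment> \<open>The witness \<open>k = 1\<close> requires \<open>2 \<le> n\<close>. For smaller
    \<open>n\<close> the range \<open>{1..n-1}\<close> is empty, so (iii) fails although (i) and
    (ii) hold; this is why the equivalence with (iii) carries that condition.\<close>
  have ii_iii: "\<exists>k\<in>{1..n-1}. ?eq k" if "\<forall>k\<in>{0..n}. ?eq k" "2 \<le> n"
  proof
    show "?eq 1" "1 \<in> {1..n-1}"
      using that by simp_all
  qed
  have ii_i: ?i if "\<forall>k\<in>{0..n}. ?eq k"
  proof (cases "2 \<le> n")
    case True
    from iii_i[OF ii_iii[OF that True]] show ?thesis .
  next
    case False
    \<comment> \<open>With at most one index, equality of all odds ratios is trivial.\<close>
    then have "{1..n} \<subseteq> {1}"
      by auto
    then show ?thesis
      by blast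
  qed
  show ?thesis
  proof (intro conjI impI)
    show "?i \<longleftrightarrow> (\<forall>k\<in>{0..n}. ?eq k)"
      using i_ii ii_i by (rule iffI)
    assume "2 \<le> n"
    show "(\<forall>k\<in>{0..n}. ?eq k) \<longleftrightarrow> (\<exists>k\<in>{1..n-1}. ?eq k)"
      using ii_iii[OF _ \<open>2 \<le> n\<close>] i_ii[OF iii_i] by (rule iffI)
  qed
qed

end
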